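(* Let $\mathcal{D}\subset\mathbb{R}^2$ be a bounded, convex, polygonal domain and let $\mathcal{T}_h$ be an admissible triangulation of $\mathcal{D}$ with maximal edge length $h\in(0,1]$. Let $(Z_T)_{T\in\mathcal{T}_h}$ be an independent family of random variables on a probability space $(\Omega,\mathcal{F},\mathbb{P})$ such that $Z_T$ is uniformly distributed on $T$, and for $v\in L^1(\mathcal{D})$ set $$Q_{MC}[v]:=\sum_{T\in\mathcal{T}_h}|T|\,v(Z_T).$$ Then: (i) For every $v\in L^1(\mathcal{D})$, $\mathbb{E}\big[Q_{MC}[v]\big]=\int_{\mathcal{D}}v(x)\,\mathrm{d}x$. (ii) If $v\in L^2(\mathcal{D})$, then $$\mathbb{E}\Big[\Big|\int_{\mathcal{D}}v(x)\,\mathrm{d}x-Q_{MC}[v]\Big|^2\Big]\le\frac{\sqrt3}{2}\,h^2\,\|v\|_{L^2(\mathcal{D})}^2.$$ (iii) If $v\in W^{s,2}(\mathcal{D})$ for some $s\in(0,1)$, then $$\mathbb{E}\Big[\Big|\int_{\mathcal{D}}v(x)\,\mathrm{d}x-Q_{MC}[v]\Big|^2\Big]\le h^{2+2s}\,|v|_{W^{s,2}(\mathcal{D})}^2.$$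
   Context: An admissible triangulation $\mathcal{T}_h$ of $\mathcal{D}$ is a finite set of pairwise disjoint open triangles $T\subset\mathcal{D}$ with $\bigcup_{T\in\mathcal{T}_h}\overline{T}=\overline{\mathcal{D}}$, such that no vertex of a triangle lies in the interior of an edge of another triangle. $|T|$ is the area of $T$. For $s\in(0,1)$, $W^{s,2}(\mathcal{D})$ is the Sobolev--Slobodeckij space of all $v\in L^2(\mathcal{D})$ for which the semi-norm $|v|_{W^{s,2}(\mathcal{D})}=\big(\int_{\mathcal{D}}\int_{\mathcal{D}}\frac{|v(x)-v(z)|^2}{|x-z|^{2+2s}}\,\mathrm{d}x\,\mathrm{d}z\big)^{1/2}$ is finite. *)

theory Defs
  imports "HOL-Probability.Probability"
begin

type_synonym plane = "real ^ 2"

text \<open>A domain is a nonempty open connected set; it is polygonal if its boundary consists of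
  finitely many line segments.\<close>

definition polygonal_domain :: "plane set \<Rightarrow> bool" where
  "polygonal_domain D \<longleftrightarrow> open D \<and> connected D \<and> D \<noteq> {} \<and>
     (\<exists>S. finite S \<and> frontier D = (\<Union>(a, b)\<in>S. closed_segment a b))"

definition open_triangle :: "plane set \<Rightarrow> bool" where
  "open_triangle T \<longleftrightarrow>
     (\<exists>a b c. \<not> collinear {a, b, c} \<and> T = interior (convex hull {a, b, c}))"

text \<open>For an open triangle \<open>T\<close>, the vertices are the extreme points of \<open>closure T\<close>, the (closed)
  edges are its one-dimensional faces, and the interior of an edge is its relative interior.\<close>

definition admissible_triangulation :: "plane set \<Rightarrow> plane set set \<Rightarrow> bool" where
  "admissible_triangulation D \<T> \<longleftrightarrow>
     finite \<T> \<and>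
     (\<forall>T\<in>\<T>. open_triangle T \<and> T \<subseteq> D) \<and>
     pairwise disjnt \<T> \<and>
     (\<Union>T\<in>\<T>. closure T) = closure D \<and>
     (\<forall>T\<in>\<T>. \<forall>T'\<in>\<T>. T \<noteq> T' \<longrightarrow>
        (\<forall>p e. p extreme_point_of closure T \<and> e edge_of closure T' \<longrightarrow> p \<notin> rel_interior e))"

definition max_edge_length :: "plane set set \<Rightarrow> real" where
  "max_edge_length \<T> = Max {diameter e | e. \<exists>T\<in>\<T>. e edge_of closure T}"

text \<open>Elements of the Lebesgue spaces are represented by real functions whose restriction to \<open>D\<close> is
  Borel measurable (every equivalence class has such a representative); values outside \<open>D\<close> are
  irrelevant. Thus \<open>L\<^sup>1(D)\<close> is \<^const>\<open>set_integrable\<close> \<open>lborel D\<close>.\<close>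

definition in_L2 :: "plane set \<Rightarrow> (plane \<Rightarrow> real) \<Rightarrow> bool" where
  "in_L2 D v \<longleftrightarrow> set_borel_measurable lborel D v \<and> set_integrable lborel D (\<lambda>x. \<bar>v x\<bar>\<^sup>2)"

definition L2_norm :: "plane set \<Rightarrow> (plane \<Rightarrow> real) \<Rightarrow> real" where
  "L2_norm D v = sqrt (LINT x:D|lborel. \<bar>v x\<bar>\<^sup>2)"

text \<open>The integrand is \<open>0\<close> on the null set \<open>x = z\<close>, by the conventions on division by zero.\<close>

definition slobodeckij_integral :: "real \<Rightarrow> plane set \<Rightarrow> (plane \<Rightarrow> real) \<Rightarrow> ennreal" where
  "slobodeckij_integral s D v =
     (\<integral>\<^sup>+x\<in>D. (\<integral>\<^sup>+z\<in>D. ennreal (\<bar>v x - v z\<bar>\<^sup>2 / norm (x - z) powr (2 + 2 * s)) \<partial>lborel) \<partial>lborel)"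

definition slobodeckij_seminorm :: "real \<Rightarrow> plane set \<Rightarrow> (plane \<Rightarrow> real) \<Rightarrow> real" where
  "slobodeckij_seminorm s D v = sqrt (enn2real (slobodeckij_integral s D v))"

definition in_Ws2 :: "real \<Rightarrow> plane set \<Rightarrow> (plane \<Rightarrow> real) \<Rightarrow> bool" where
  "in_Ws2 s D v \<longleftrightarrow> in_L2 D v \<and> slobodeckij_integral s D v < \<infinity>"

definition uniformly_distributed_on :: "'a measure \<Rightarrow> ('a \<Rightarrow> plane) \<Rightarrow> plane set \<Rightarrow> bool" where
  "uniformly_distributed_on M X T \<longleftrightarrow>
     X \<in> borel_measurable M \<and> distr M lborel X = uniform_measure lborel T"

text \<open>A uniformly distributed point lies in \<open>T \<subseteq> D\<close> almost surely, but not necessarily surely.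
  The factor \<^const>\<open>indicator\<close> extends \<open>v\<close>, a function on \<open>D\<close>, by zero; it is \<open>1\<close> almost surely.\<close>

definition Q_MC ::
  "plane set \<Rightarrow> plane set set \<Rightarrow> (plane set \<Rightarrow> 'a \<Rightarrow> plane) \<Rightarrow> (plane \<Rightarrow> real) \<Rightarrow> 'a \<Rightarrow> real" where
  "Q_MC D \<T> Z v \<omega> = (\<Sum>T\<in>\<T>. measure lborel T * (indicator D (Z T \<omega>) * v (Z T \<omega>)))"

end

theory Submission
  imports Defs
begin

text \<open>The triangles cover \<open>D\<close> up to the null set of their boundaries, so \<open>\<integral>\<^sub>D v\<close> is the sum of the
  \<open>\<integral>\<^sub>T v = \<bar>T\<bar> E[v(Z\<^sub>T)]\<close>. Hence \<open>Q\<^sub>M\<^sub>C\<close> is unbiased and, by independence, its mean square error is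
  the sum over \<open>T\<close> of
  \<open>\<bar>T\<bar> \<integral>\<^sub>T v\<^sup>2 - (\<integral>\<^sub>T v)\<^sup>2 = 1/2 \<integral>\<^sub>T \<integral>\<^sub>T (v(x) - v(z))\<^sup>2 dx dz\<close>.
  Dropping the subtracted square and using \<open>\<bar>T\<bar> \<le> h\<^sup>2/2\<close> gives the \<open>L\<^sup>2\<close> bound; inserting
  \<open>\<bar>x - z\<bar> \<le> h\<close> into the double integral gives the Slobodeckij bound.\<close>

section \<open>Variances of independent sums and integrals of squared differences\<close>

text \<open>A new summand is independent of the sum of the earlier ones, so the expectation of their
  product factorises and the mixed term cancels in the variance. Both claims share one induction,
  since the variance formula in its step needs the squared partial sum to be integrable.\<close>

lemma (in prob_space) variance_sum_indep_vars:
  fixes X :: "'i \<Rightarrow> 'a \<Rightarrow> real"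
  assumes "finite I" and "indep_vars (\<lambda>_. borel) X I"
    and "\<And>i. i \<in> I \<Longrightarrow> integrable M (X i)" and "\<And>i. i \<in> I \<Longrightarrow> integrable M (\<lambda>\<omega>. (X i \<omega>)\<^sup>2)"
  shows "integrable M (\<lambda>\<omega>. (\<Sum>i\<in>I. X i \<omega>)\<^sup>2)"
    and "variance (\<lambda>\<omega>. \<Sum>i\<in>I. X i \<omega>) = (\<Sum>i\<in>I. variance (X i))"
proof -
  have "integrable M (\<lambda>\<omega>. (\<Sum>i\<in>I. X i \<omega>)\<^sup>2)
      \<and> variance (\<lambda>\<omega>. \<Sum>i\<in>I. X i \<omega>) = (\<Sum>i\<in>I. variance (X i))"
    using assms
  proof (induction I rule: finite_induct)
    case empty
    then show ?case by simp
  next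
    case (insert i I)
    let ?S = "\<lambda>\<omega>. \<Sum>j\<in>I. X j \<omega>"
    have X: "integrable M (X i)" "integrable M (\<lambda>\<omega>. (X i \<omega>)\<^sup>2)"
      using insert.prems by auto
    have IH: "integrable M (\<lambda>\<omega>. (?S \<omega>)\<^sup>2)" "variance ?S = (\<Sum>j\<in>I. variance (X j))"
      using insert.IH insert.prems indep_vars_subset[OF insert.prems(1)] by auto
    have S: "integrable M ?S"
      using insert.prems by auto
    have ind: "indep_var borel (X i) borel ?S"
      using insert.hyps insert.prems(1) by (rule indep_vars_sum)
    have XS: "integrable M (\<lambda>\<omega>. X i \<omega> * ?S \<omega>)"
        "expectation (\<lambda>\<omega>. X i \<omega> * ?S \<omega>) = expectation (X i) * expectation ?S"
      using indep_var_integrable[OF ind X(1) S] indep_var_lebesgue_integral[OF ind X(1) S] by auto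
    have expand: "(X i \<omega> + ?S \<omega>)\<^sup>2 = (X i \<omega>)\<^sup>2 + (?S \<omega>)\<^sup>2 + 2 * (X i \<omega> * ?S \<omega>)" for \<omega>
      by (simp add: power2_sum)
    have int: "integrable M (\<lambda>\<omega>. (X i \<omega> + ?S \<omega>)\<^sup>2)"
      unfolding expand using X IH XS by simp
    have E2: "expectation (\<lambda>\<omega>. (X i \<omega> + ?S \<omega>)\<^sup>2) = expectation (\<lambda>\<omega>. (X i \<omega>)\<^sup>2)
        + expectation (\<lambda>\<omega>. (?S \<omega>)\<^sup>2) + 2 * (expectation (X i) * expectation ?S)"
      unfolding expand using X IH XS by simp
    have E1: "expectation (\<lambda>\<omega>. X i \<omega> + ?S \<omega>) = expectation (X i) + expectation ?S"
      using X(1) S by (rule Bochner_Integration.integral_add)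
    have "variance (\<lambda>\<omega>. X i \<omega> + ?S \<omega>) = variance (X i) + variance ?S"
      unfolding variance_eq[OF X] variance_eq[OF S IH(1)]
        variance_eq[OF Bochner_Integration.integrable_add[OF X(1) S] int]
      unfolding E1 E2
      by (simp add: power2_sum)
    then show ?case
      using insert.hyps int IH by simp
  qed
  then show "integrable M (\<lambda>\<omega>. (\<Sum>i\<in>I. X i \<omega>)\<^sup>2)"
    and "variance (\<lambda>\<omega>. \<Sum>i\<in>I. X i \<omega>) = (\<Sum>i\<in>I. variance (X i))"
    by auto
qed

text \<open>Expanding the square and integrating twice, each pure square contributes the total mass
  times the integral of \<open>f\<close> squared, and the mixed term contributes minus twice the
  squared integral of \<open>f\<close>. The left side is an \<open>ennreal\<close> integral so that
  it can be compared with \<open>slobodeckij_integral\<close>.\<close>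

lemma (in finite_measure) nn_integral_square_difference:
  fixes f :: "'a \<Rightarrow> real"
  assumes f: "integrable M f" and f2: "integrable M (\<lambda>x. (f x)\<^sup>2)"
  shows "(\<integral>\<^sup>+x. \<integral>\<^sup>+z. ennreal ((f x - f z)\<^sup>2) \<partial>M \<partial>M)
    = ennreal (2 * (measure M (space M) * (\<integral>x. (f x)\<^sup>2 \<partial>M) - (\<integral>x. f x \<partial>M)\<^sup>2))"
proof -
  define m where "m = measure M (space M)"
  define a where "a = (\<integral>x. f x \<partial>M)"
  define b where "b = (\<integral>x. (f x)\<^sup>2 \<partial>M)"
  have expand: "(f x - f z)\<^sup>2 = (f x)\<^sup>2 + (f z)\<^sup>2 - 2 * f x * f z" for x z
    by (simp add: power2_diff)
  \<comment> \<open>Nonnegativity is recorded along with the value, because \<open>ennreal\<close>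
    would truncate a negative number to \<open>0\<close> in the outer integration. It holds because
    the value is the integral of a square.\<close>
  have inner: "(\<integral>\<^sup>+z. ennreal ((f x - f z)\<^sup>2) \<partial>M) = ennreal (m * (f x)\<^sup>2 + b - 2 * f x * a)" (is ?A)
    and nonneg: "0 \<le> m * (f x)\<^sup>2 + b - 2 * f x * a" (is ?B) for x
  proof -
    have int: "integrable M (\<lambda>z. (f x - f z)\<^sup>2)"
      unfolding expand using f f2 by simp
    have eq: "(\<integral>z. (f x - f z)\<^sup>2 \<partial>M) = m * (f x)\<^sup>2 + b - 2 * f x * a"
      unfolding expand using f f2 by (simp add: m_def a_def b_def)
    show ?A
      using nn_integral_eq_integral[OF int] eq by simp
    have "0 \<le> (\<integral>z. (f x - f z)\<^sup>2 \<partial>M)"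
      by (rule Bochner_Integration.integral_nonneg) simp
    then show ?B
      unfolding eq .
  qed
  have "integrable M (\<lambda>x. m * (f x)\<^sup>2 + b - 2 * f x * a)"
    using f f2 by simp
  moreover have "(\<integral>x. m * (f x)\<^sup>2 + b - 2 * f x * a \<partial>M) = 2 * (m * b - a\<^sup>2)"
    using f f2 by (simp add: m_def[symmetric] a_def[symmetric] b_def[symmetric] right_diff_distrib)
      (simp add: power2_eq_square)
  ultimately show ?thesis
    unfolding inner m_def[symmetric] a_def[symmetric] b_def[symmetric]
    by (subst nn_integral_eq_integral) (use nonneg in auto)
qed

text \<open>Integrating \<open>g\<close> over a set is evaluating the measure
  \<open>density M g\<close> there, so this is additivity and monotonicity of that measure.\<close>

lemma sum_nn_integral_disjoint_le:
  assumes "finite \<T>" and "pairwise disjnt \<T>" and "\<T> \<subseteq> sets M" and "D \<in> sets M"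
    and "\<And>T. T \<in> \<T> \<Longrightarrow> T \<subseteq> D" and g: "g \<in> borel_measurable M"
  shows "(\<Sum>T\<in>\<T>. \<integral>\<^sup>+x\<in>T. g x \<partial>M) \<le> (\<integral>\<^sup>+x\<in>D. g x \<partial>M)"
proof -
  have disj: "disjoint_family_on (\<lambda>T. T) \<T>"
    using assms(2) by (auto simp: disjoint_family_on_def pairwise_def disjnt_def)
  have "(\<Sum>T\<in>\<T>. \<integral>\<^sup>+x\<in>T. g x \<partial>M) = (\<Sum>T\<in>\<T>. emeasure (density M g) T)"
    using assms(3) g by (intro sum.cong) (auto simp: emeasure_density)
  also have "\<dots> = emeasure (density M g) (\<Union>T\<in>\<T>. T)"
    using assms(1,3) disj by (intro sum_emeasure) auto
  also have "\<dots> \<le> emeasure (density M g) D"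
    using assms by (intro emeasure_mono) auto
  also have "\<dots> = (\<integral>\<^sup>+x\<in>D. g x \<partial>M)"
    using assms(4) g by (simp add: emeasure_density)
  finally show ?thesis .
qed

section \<open>Uniformly distributed points\<close>

text \<open>The law of \<open>X\<close> has density \<open>1 / measure lborel T\<close> on
  \<open>T\<close>, and the factor \<open>measure lborel T\<close>, which is the quadrature weight
  of \<open>T\<close>, cancels this normalisation.\<close>

lemma uniformly_distributed_on_integral:
  fixes f :: "plane \<Rightarrow> real"
  assumes X: "uniformly_distributed_on M X T" and T: "T \<in> sets borel"
    and pos: "0 < emeasure lborel T" and fin: "emeasure lborel T < \<infinity>"
    and f [measurable]: "f \<in> borel_measurable borel" and int: "set_integrable lborel T f"
  shows "integrable M (\<lambda>\<omega>. f (X \<omega>))"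
    and "measure lborel T * (\<integral>\<omega>. f (X \<omega>) \<partial>M) = (LINT x:T|lborel. f x)"
proof -
  have X_meas [measurable]: "X \<in> measurable M lborel" and distr: "distr M lborel X = uniform_measure lborel T"
    using X by (auto simp: uniformly_distributed_on_def)
  have m: "emeasure lborel T = ennreal (measure lborel T)" "0 < measure lborel T"
  proof -
    show m: "emeasure lborel T = ennreal (measure lborel T)"
      using fin by (intro emeasure_eq_ennreal_measure) auto
    show "0 < measure lborel T"
      using pos unfolding m by (simp only: ennreal_less_zero_iff)
  qed
  \<comment> \<open>The quotient in \<open>uniform_measure\<close> is taken in
    \<open>ennreal\<close>; as the area is positive and finite it is a real quotient, which the
    rules for real densities require.\<close>
  have "indicator T x / emeasure lborel T = ennreal (indicator T x / measure lborel T)" for x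
    unfolding m(1) using m(2) divide_ennreal[of 1 "measure lborel T"]
    by (simp split: split_indicator)
  then have u: "uniform_measure lborel T = density lborel (\<lambda>x. indicator T x / measure lborel T)"
    by (simp add: uniform_measure_def)
  have scaled: "(indicator T x / measure lborel T) *\<^sub>R f x = (indicator T x *\<^sub>R f x) / measure lborel T"
    for x by simp
  have "integrable (density lborel (\<lambda>x. indicator T x / measure lborel T)) f"
    using T int by (subst integrable_density) (auto simp: set_integrable_def scaled simp del: real_scaleR_def)
  then show "integrable M (\<lambda>\<omega>. f (X \<omega>))"
    using integrable_distr_eq[OF X_meas, of f] by (simp add: distr u)
  have "(\<integral>\<omega>. f (X \<omega>) \<partial>M) = (\<integral>x. f x \<partial>distr M lborel X)"
    by (subst integral_distr) (use X_meas in auto)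
  also have "\<dots> = (LINT x:T|lborel. f x) / measure lborel T"
    unfolding distr u set_lebesgue_integral_def
    using T by (subst integral_density) (auto simp: scaled simp del: real_scaleR_def)
  finally show "measure lborel T * (\<integral>\<omega>. f (X \<omega>) \<partial>M) = (LINT x:T|lborel. f x)"
    using m(2) by simp
qed

section \<open>Geometry of triangles\<close>

text \<open>Three non-collinear points are affinely independent, so the hull of any subset is a
  face; the hull of two distinct points has dimension one.\<close>

lemma closed_segment_edge_of_triangle:
  fixes a b c :: plane
  assumes "\<not> collinear {a, b, c}"
  shows "closed_segment a b edge_of convex hull {a, b, c}"
proof -
  have "\<not> affine_dependent {a, b, c}" "a \<noteq> b"
    using assms by (auto simp: collinear_3_eq_affine_dependent)
  then have "closed_segment a b face_of convex hull {a, b, c}"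
    unfolding segment_convex_hull
    by (subst face_of_convex_hull_affine_independent) (auto intro!: exI[of _ "{a, b}"])
  then show ?thesis
    using \<open>a \<noteq> b\<close> by (simp add: edge_of_def segment_convex_hull aff_dim_convex_hull aff_dim_2)
qed

text \<open>The distance of two points in the hull of finitely many points is at most that of some
  two generating points, and any two distinct vertices of a triangle are joined by an edge.\<close>

lemma dist_in_triangle_le:
  fixes a b c :: plane
  assumes "\<not> collinear {a, b, c}"
    and edges: "\<And>e. e edge_of convex hull {a, b, c} \<Longrightarrow> diameter e \<le> h"
    and "x \<in> convex hull {a, b, c}" "y \<in> convex hull {a, b, c}"
  shows "dist x y \<le> h"
proof -
  have side: "dist p q \<le> h" if "closed_segment p q edge_of convex hull {a, b, c}" for p q
    using edges[OF that] diameter_bounded_bound[of "closed_segment p q" p q]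
    by (force simp: bounded_closed_segment)
  have "dist a b \<le> h" "dist b c \<le> h" "dist c a \<le> h"
    using side closed_segment_edge_of_triangle[of a b c] closed_segment_edge_of_triangle[of b c a]
      closed_segment_edge_of_triangle[of c a b] assms(1) by (simp_all add: insert_commute)
  \<comment> \<open>This covers the case in which the two extremal vertices found below
    coincide.\<close>
  moreover have "0 \<le> h"
    using \<open>dist a b \<le> h\<close> zero_le_dist order_trans by blast
  moreover obtain u v where "u \<in> {a, b, c}" "v \<in> {a, b, c}" "dist x y \<le> dist u v"
    using simplex_extremal_le_exists[OF _ assms(3,4)] unfolding dist_norm by blast
  ultimately show ?thesis
    by (auto simp: dist_commute)
qed

text \<open>The area is half the absolute value of the determinant of the side vectors at
  \<open>a\<close>, and the determinant is at most the product of their lengths.\<close>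

lemma content_triangle_le:
  fixes a b c :: plane
  shows "measure lborel (convex hull {a, b, c}) \<le> dist b a * dist c a / 2"
proof -
  have cs: "\<bar>p * s - q * r\<bar> \<le> sqrt (p\<^sup>2 + q\<^sup>2) * sqrt (r\<^sup>2 + s\<^sup>2)" for p q r s :: real
  proof -
    \<comment> \<open>By Lagrange's identity the two sides differ by the square of
      \<open>p * r + q * s\<close>.\<close>
    have "(p * s - q * r)\<^sup>2 \<le> (p\<^sup>2 + q\<^sup>2) * (r\<^sup>2 + s\<^sup>2)"
      using zero_le_power2[of "p * r + q * s"] by (simp add: power2_eq_square algebra_simps)
    then show ?thesis
      by (metis real_sqrt_abs real_sqrt_le_mono real_sqrt_mult)
  qed
  have d: "dist x y = sqrt ((x $ 1 - y $ 1)\<^sup>2 + (x $ 2 - y $ 2)\<^sup>2)" for x y :: plane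
    by (simp add: dist_vec_def L2_set_def sum_2 dist_real_def)
  show ?thesis
    unfolding content_triangle d
    \<comment> \<open>The list instantiates \<open>p, s, q, r\<close> in their order of occurrence:
      \<open>(p, q)\<close> is the side vector \<open>c - a\<close> and \<open>(r, s)\<close> is
      \<open>b - a\<close>.\<close>
    using cs[of "c $ 1 - a $ 1" "b $ 2 - a $ 2" "c $ 2 - a $ 2" "b $ 1 - a $ 1"]
    by (simp add: mult.commute add.commute)
qed

text \<open>Non-collinearity gives the hull a nonempty interior, so the hull is the closure of
  \<open>T\<close>. Hence the edges of \<open>closure T\<close> are those of the hull, and the
  estimates for closed triangles apply with any bound \<open>h\<close> on the edge lengths.\<close>

lemma open_triangle_properties:
  assumes "open_triangle T"
  shows "open T" "bounded T" "convex T" "T \<noteq> {}"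
    and "finite {e. e edge_of closure T}"
    and "\<lbrakk>\<And>e. e edge_of closure T \<Longrightarrow> diameter e \<le> h; x \<in> T; y \<in> T\<rbrakk> \<Longrightarrow> dist x y \<le> h"
    and "(\<And>e. e edge_of closure T \<Longrightarrow> diameter e \<le> h) \<Longrightarrow> measure lborel T \<le> h\<^sup>2 / 2"
proof -
  obtain a b c where ncol: "\<not> collinear {a, b, c}" and T: "T = interior (convex hull {a, b, c})"
    using assms by (auto simp: open_triangle_def)
  let ?H = "convex hull {a, b, c}"
  have "a \<noteq> b" "a \<noteq> c" "b \<noteq> c" and indep: "\<not> affine_dependent {a, b, c}"
    using ncol by (auto simp: collinear_3_eq_affine_dependent)
  then have "card {a, b, c} = Suc (DIM(plane))"
    by simp
  then show ne: "T \<noteq> {}"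
    unfolding T using indep interior_convex_hull_eq_empty by blast
  have "compact ?H"
    by (simp add: finite_imp_compact_convex_hull)
  then have clos: "closure T = ?H"
    using ne unfolding T by (simp add: convex_closure_interior compact_imp_closed)
  show "open T" "convex T"
    by (simp_all add: T convex_interior)
  show "bounded T"
    unfolding T using \<open>compact ?H\<close> bounded_interior compact_imp_bounded by blast
  \<comment> \<open>A polytope has finitely many faces; this later makes the \<open>Max\<close> in
    \<open>max_edge_length\<close> range over a finite set.\<close>
  have "polytope ?H"
    by (simp add: polytope_convex_hull)
  from finite_polytope_faces[OF this] show "finite {e. e edge_of closure T}"
    unfolding clos edge_of_def by (rule rev_finite_subset) auto
  show "dist x y \<le> h" if "\<And>e. e edge_of closure T \<Longrightarrow> diameter e \<le> h" "x \<in> T" "y \<in> T"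
  proof (rule dist_in_triangle_le[OF ncol])
    show "x \<in> ?H" "y \<in> ?H"
      using that(2,3) closure_subset[of T] clos by auto
  qed (use that(1) clos in auto)
  show "measure lborel T \<le> h\<^sup>2 / 2" if "\<And>e. e edge_of closure T \<Longrightarrow> diameter e \<le> h"
  proof -
    have d: "dist b a \<le> h" "dist c a \<le> h"
      by (rule dist_in_triangle_le[OF ncol]; use that clos in \<open>simp add: hull_inc\<close>)+
    have "measure lborel T \<le> measure lborel ?H"
      unfolding T using \<open>compact ?H\<close>
      by (intro measure_mono_fmeasurable interior_subset fmeasurable_compact) auto
    also have "\<dots> \<le> dist b a * dist c a / 2"
      by (rule content_triangle_le)
    also have "\<dots> \<le> h * h / 2"
      using d order_trans[OF zero_le_dist d(1)] by (intro divide_right_mono mult_mono) auto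
    finally show ?thesis
      by (simp add: power2_eq_square)
  qed
qed

section \<open>Error contribution of a single triangle\<close>

text \<open>In the second moment minus the squared mean, the second moment carries the area squared,
  of which one factor cancels against the uniform density.\<close>

lemma (in prob_space) variance_scaled_uniform:
  fixes f :: "plane \<Rightarrow> real"
  assumes X: "uniformly_distributed_on M X T" and T: "T \<in> sets borel"
    and pos: "0 < emeasure lborel T" and fin: "emeasure lborel T < \<infinity>"
    and f [measurable]: "f \<in> borel_measurable borel"
    and int: "set_integrable lborel T f" "set_integrable lborel T (\<lambda>x. (f x)\<^sup>2)"
  shows "integrable M (\<lambda>\<omega>. (f (X \<omega>))\<^sup>2)"
    and "variance (\<lambda>\<omega>. measure lborel T * f (X \<omega>))
      = measure lborel T * (LINT x:T|lborel. (f x)\<^sup>2) - (LINT x:T|lborel. f x)\<^sup>2"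
proof -
  have f2: "(\<lambda>x. (f x)\<^sup>2) \<in> borel_measurable borel"
    by simp
  note E1 = uniformly_distributed_on_integral[OF X T pos fin f int(1)]
  note E2 = uniformly_distributed_on_integral[OF X T pos fin f2 int(2)]
  show "integrable M (\<lambda>\<omega>. (f (X \<omega>))\<^sup>2)"
    by (fact E2(1))
  have "variance (\<lambda>\<omega>. measure lborel T * f (X \<omega>))
      = (measure lborel T)\<^sup>2 * expectation (\<lambda>\<omega>. (f (X \<omega>))\<^sup>2)
        - (measure lborel T * expectation (\<lambda>\<omega>. f (X \<omega>)))\<^sup>2"
    using E1(1) E2(1) by (subst variance_eq) (simp_all add: power_mult_distrib)
  also have "\<dots> = measure lborel T * (LINT x:T|lborel. (f x)\<^sup>2) - (LINT x:T|lborel. f x)\<^sup>2"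
    unfolding E1(2)[symmetric] E2(2)[symmetric] by (simp add: power2_eq_square)
  finally show "variance (\<lambda>\<omega>. measure lborel T * f (X \<omega>))
      = measure lborel T * (LINT x:T|lborel. (f x)\<^sup>2) - (LINT x:T|lborel. f x)\<^sup>2" .
qed

text \<open>Twice the left side is the double integral over \<open>T\<close> of the squared
  differences, and each of these is at most \<open>h powr (2 + 2 * s)\<close> times the Slobodeckij
  integrand since \<open>norm (x - z) \<le> h\<close>.\<close>

lemma variance_le_slobodeckij:
  fixes f :: "plane \<Rightarrow> real"
  assumes T: "T \<in> sets borel" and fin: "emeasure lborel T < \<infinity>"
    and f [measurable]: "f \<in> borel_measurable borel"
    and int: "set_integrable lborel T f" "set_integrable lborel T (\<lambda>x. (f x)\<^sup>2)"
    and dist: "\<And>x y. \<lbrakk>x \<in> T; y \<in> T\<rbrakk> \<Longrightarrow> dist x y \<le> h" and "0 \<le> s"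
  shows "ennreal (measure lborel T * (LINT x:T|lborel. (f x)\<^sup>2) - (LINT x:T|lborel. f x)\<^sup>2)
    \<le> ennreal (h powr (2 + 2 * s)) * slobodeckij_integral s T f" (is "ennreal ?V \<le> _")
proof -
  let ?c = "h powr (2 + 2 * s)"
  let ?q = "\<lambda>x z. ennreal (\<bar>f x - f z\<bar>\<^sup>2 / norm (x - z) powr (2 + 2 * s))"
  have [measurable]: "T \<in> sets borel"
    by (fact T)
  \<comment> \<open>Restricting Lebesgue measure to \<open>T\<close> makes integrals over
    \<open>T\<close> into integrals over a whole space of total mass
    \<open>measure lborel T\<close>.\<close>
  interpret N: finite_measure "restrict_space lborel T"
    using T fin by (intro finite_measureI) (simp add: space_restrict_space emeasure_restrict_space)
  have integral_N: "integral\<^sup>L (restrict_space lborel T) g = (LINT x:T|lborel. g x)" for g :: "plane \<Rightarrow> real"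
    using T by (simp add: integral_restrict_space set_lebesgue_integral_def)
  have nn_integral_N: "integral\<^sup>N (restrict_space lborel T) g = (\<integral>\<^sup>+x\<in>T. g x \<partial>lborel)" for g
    using T by (simp add: nn_integral_restrict_space)
  have "ennreal (2 * ?V) = (\<integral>\<^sup>+x\<in>T. (\<integral>\<^sup>+z\<in>T. ennreal ((f x - f z)\<^sup>2) \<partial>lborel) \<partial>lborel)"
    using N.nn_integral_square_difference[of f] T int unfolding integral_N nn_integral_N
    by (simp add: integrable_restrict_space set_integrable_def measure_restrict_space space_restrict_space)
  also have "\<dots> \<le> (\<integral>\<^sup>+x\<in>T. (\<integral>\<^sup>+z\<in>T. ennreal ?c * ?q x z \<partial>lborel) \<partial>lborel)"
  proof -
    have "ennreal ((f x - f z)\<^sup>2) \<le> ennreal ?c * ?q x z" if "x \<in> T" "z \<in> T" for x z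
    \<comment> \<open>On the diagonal the left side is \<open>0\<close>; off it the denominator is
      positive and can be cleared.\<close>
    proof (cases "x = z")
      case False
      let ?n = "norm (x - z) powr (2 + 2 * s)"
      have "?n \<le> ?c" "0 < ?n"
        using dist[OF that] False \<open>0 \<le> s\<close> by (auto simp: dist_norm intro: powr_mono2)
      then have "(f x - f z)\<^sup>2 * ?n \<le> (f x - f z)\<^sup>2 * ?c"
        by (intro mult_left_mono) auto
      then have "(f x - f z)\<^sup>2 \<le> ?c * (\<bar>f x - f z\<bar>\<^sup>2 / ?n)"
        using \<open>0 < ?n\<close> by (simp add: field_simps)
      then show ?thesis
        by (simp add: ennreal_mult'[symmetric] ennreal_leI)
    qed simp
    then show ?thesis
      by (intro nn_integral_mono) (auto intro!: nn_integral_mono split: split_indicator)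
  qed
  also have "\<dots> = ennreal ?c * slobodeckij_integral s T f"
    unfolding slobodeckij_integral_def
    by (simp add: mult.assoc nn_integral_cmult)
  finally have "ennreal (2 * ?V) \<le> ennreal ?c * slobodeckij_integral s T f" .
  \<comment> \<open>The gain of a factor \<open>1/2\<close> is given up here. The sign of
    \<open>?V\<close> is not known at this point, but a negative value is truncated to
    \<open>0\<close> on both sides.\<close>
  moreover have "ennreal ?V \<le> ennreal (2 * ?V)"
    by (cases "0 \<le> ?V") (simp_all add: ennreal_leI ennreal_neg)
  ultimately show ?thesis
    by (rule order_trans[rotated])
qed

section \<open>Integrals over the domain\<close>

text \<open>The sum only sees the diagonal blocks of \<open>D\<close> times \<open>D\<close>:
  enlarge the inner domain from \<open>T\<close> to \<open>D\<close>, then use that the outer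
  domains are disjoint subsets of \<open>D\<close>.\<close>

lemma sum_slobodeckij_integral_le:
  assumes "finite \<T>" and "pairwise disjnt \<T>" and T: "\<And>T. T \<in> \<T> \<Longrightarrow> T \<in> sets borel \<and> T \<subseteq> D"
    and D [measurable]: "D \<in> sets borel" and f [measurable]: "f \<in> borel_measurable borel"
  shows "(\<Sum>T\<in>\<T>. slobodeckij_integral s T f) \<le> slobodeckij_integral s D f"
proof -
  let ?q = "\<lambda>x z. ennreal (\<bar>f x - f z\<bar>\<^sup>2 / norm (x - z) powr (2 + 2 * s))"
  have "(\<Sum>T\<in>\<T>. slobodeckij_integral s T f)
      \<le> (\<Sum>T\<in>\<T>. \<integral>\<^sup>+x\<in>T. (\<integral>\<^sup>+z\<in>D. ?q x z \<partial>lborel) \<partial>lborel)"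
    unfolding slobodeckij_integral_def using T
    by (intro sum_mono nn_integral_mono mult_right_mono) (auto split: split_indicator)
  also have "\<dots> \<le> slobodeckij_integral s D f"
    unfolding slobodeckij_integral_def using assms
    by (intro sum_nn_integral_disjoint_le) auto
  finally show ?thesis .
qed

lemma slobodeckij_integral_cong:
  assumes "\<And>x. x \<in> D \<Longrightarrow> f x = g x"
  shows "slobodeckij_integral s D f = slobodeckij_integral s D g"
  unfolding slobodeckij_integral_def
  by (intro nn_integral_cong) (auto intro!: nn_integral_cong simp: assms split: split_indicator)

lemma in_L2_imp_set_integrable:
  assumes "in_L2 D v" and "D \<in> sets borel" and "bounded D"
  shows "set_integrable lborel D v"
proof (rule set_integrable_bound)
  have "emeasure lborel D < \<infinity>"
    using assms(3) by (rule emeasure_bounded_finite)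
  then have "set_integrable lborel D (\<lambda>x. 1 :: real)"
    using assms(2) by (simp add: set_integrable_def)
  then show "set_integrable lborel D (\<lambda>x. 1 + \<bar>v x\<bar>\<^sup>2)"
    using assms(1) by (intro set_integral_add) (auto simp: in_L2_def)
  show "set_borel_measurable lborel D v"
    using assms(1) by (simp add: in_L2_def)
  \<comment> \<open>Expanding the square of \<open>\<bar>t\<bar> - 1\<close> gives this; the
    dominating function is integrable because a bounded \<open>D\<close> has finite measure.\<close>
  have "\<bar>t\<bar> \<le> \<bar>1 + \<bar>t\<bar>\<^sup>2\<bar>" for t :: real
    using zero_le_power2[of "\<bar>t\<bar> - 1"] by (simp add: power2_eq_square algebra_simps)
  then show "AE x in lborel. x \<in> D \<longrightarrow> norm (v x) \<le> norm (1 + \<bar>v x\<bar>\<^sup>2)"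
    by auto
qed

section \<open>Admissible triangulations\<close>

lemma admissible_triangulation_triangle:
  assumes "admissible_triangulation D \<T>" and "T \<in> \<T>"
  shows "open_triangle T" "T \<subseteq> D" "T \<in> sets borel"
    and "0 < emeasure lborel T" "emeasure lborel T < \<infinity>"
    and "\<lbrakk>x \<in> T; y \<in> T\<rbrakk> \<Longrightarrow> dist x y \<le> max_edge_length \<T>"
    and "measure lborel T \<le> (max_edge_length \<T>)\<^sup>2 / 2"
proof -
  have \<T>: "finite \<T>" "\<And>T. T \<in> \<T> \<Longrightarrow> open_triangle T"
    using assms(1) by (auto simp: admissible_triangulation_def)
  show tri: "open_triangle T" "T \<subseteq> D"
    using assms by (auto simp: admissible_triangulation_def)
  note T = open_triangle_properties[OF tri(1)]
  show "T \<in> sets borel"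
    using T(1) by simp
  \<comment> \<open>A nonempty open set is not Lebesgue negligible.\<close>
  have "T \<notin> null_sets lborel"
    using T(1,4) open_not_negligible negligible_iff_null_sets null_sets_completionI by blast
  then show "0 < emeasure lborel T"
    using T(1) by (auto simp: null_sets_def zero_less_iff_neq_zero)
  show "emeasure lborel T < \<infinity>"
    using T(2) by (rule emeasure_bounded_finite)
  have "{diameter e |e. \<exists>T\<in>\<T>. e edge_of closure T} = (\<Union>T\<in>\<T>. diameter ` {e. e edge_of closure T})"
    by auto
  then have "finite {diameter e |e. \<exists>T\<in>\<T>. e edge_of closure T}"
    using \<T> open_triangle_properties(5) by auto
  then have edges: "diameter e \<le> max_edge_length \<T>" if "e edge_of closure T" for e
    unfolding max_edge_length_def using that assms(2) by (intro Max_ge) auto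
  show "dist x y \<le> max_edge_length \<T>" if "x \<in> T" "y \<in> T"
    using edges that by (rule T(6))
  show "measure lborel T \<le> (max_edge_length \<T>)\<^sup>2 / 2"
    using edges by (rule T(7))
qed

text \<open>A point of \<open>D\<close> outside every open triangle still lies in the closure of
  one, hence on its frontier, and frontiers of convex sets are null.\<close>

lemma admissible_triangulation_integral:
  fixes g :: "plane \<Rightarrow> real"
  assumes adm: "admissible_triangulation D \<T>" and "open D" and int: "set_integrable lborel D g"
  shows "(LINT x:D|lborel. g x) = (\<Sum>T\<in>\<T>. LINT x:T|lborel. g x)"
proof -
  note T = admissible_triangulation_triangle[OF adm]
  have \<T>: "finite \<T>" "pairwise disjnt \<T>" "(\<Union>T\<in>\<T>. closure T) = closure D"
    using adm by (auto simp: admissible_triangulation_def)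
  have intT: "set_integrable lborel T g" if "T \<in> \<T>" for T
    using int T(2,3)[OF that] by (rule_tac set_integrable_subset) auto
  have "AE x in lborel. x \<notin> frontier T" if "T \<in> \<T>" for T
  proof (rule AE_not_in)
    \<comment> \<open>Negligibility concerns completed Lebesgue measure; as a frontier is closed,
      hence Borel, it is null for \<open>lborel\<close> as well.\<close>
    have "frontier T \<in> null_sets lebesgue"
      using open_triangle_properties(3)[OF T(1)[OF that]] negligible_convex_frontier
      by (auto simp: negligible_iff_null_sets)
    then show "frontier T \<in> null_sets lborel"
      by (simp add: null_sets_completion_iff)
  qed
  then have "AE x in lborel. \<forall>T\<in>\<T>. x \<notin> frontier T"
    using \<T>(1) by (simp add: AE_finite_all)
  then have "AE x in lborel. x \<in> D \<longleftrightarrow> x \<in> (\<Union>T\<in>\<T>. T)"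
  proof eventually_elim
    case (elim x)
    show ?case
    proof
      assume "x \<in> D"
      then obtain T where "T \<in> \<T>" "x \<in> closure T"
        using \<T>(3) closure_subset[of D] by auto
      then show "x \<in> (\<Union>T\<in>\<T>. T)"
        using elim open_triangle_properties(1)[OF T(1)] by (auto simp: frontier_def interior_open)
    next
      assume "x \<in> (\<Union>T\<in>\<T>. T)"
      then show "x \<in> D"
        using T(2) by auto
    qed
  qed
  moreover have "set_integrable lborel (\<Union>T\<in>\<T>. T) g"
    using \<T>(1) T(2,3) int by (intro set_integrable_subset[OF int]) auto
  ultimately have "(LINT x:D|lborel. g x) = (LINT x:(\<Union>T\<in>\<T>. T)|lborel. g x)"
    using int by (intro set_integral_cong_set)
      (auto simp: set_integrable_def set_borel_measurable_def)
  also have "\<dots> = (\<Sum>T\<in>\<T>. LINT x:T|lborel. g x)"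
    using \<T> intT T(3)
    by (intro set_integral_finite_Union) (auto simp: disjoint_family_on_def pairwise_def disjnt_def)
  finally show ?thesis .
qed

section \<open>Expectation and mean square error of the quadrature\<close>

lemma (in prob_space) Q_MC_expectation:
  assumes adm: "admissible_triangulation D \<T>" and "open D"
    and Z: "\<And>T. T \<in> \<T> \<Longrightarrow> uniformly_distributed_on M (Z T) T"
    and v: "set_integrable lborel D v"
  shows "integrable M (Q_MC D \<T> Z v)"
    and "expectation (Q_MC D \<T> Z v) = (LINT x:D|lborel. v x)"
proof -
  note T = admissible_triangulation_triangle[OF adm]
  \<comment> \<open>Only the restriction of \<open>v\<close> to \<open>D\<close> is known to be
    measurable. Its extension by zero is Borel on the whole plane, agrees with \<open>v\<close> on
    every triangle and is the function that \<open>Q_MC\<close> evaluates.\<close>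
  define f where "f x = indicator D x * v x" for x
  have f: "f \<in> borel_measurable borel" "set_integrable lborel T f" if "T \<in> \<T>" for T
  proof -
    have *: "integrable lborel f"
      using v by (simp add: set_integrable_def f_def[abs_def])
    then show "f \<in> borel_measurable borel"
      by (auto dest: borel_measurable_integrable)
    show "set_integrable lborel T f"
      unfolding set_integrable_def using * T(3)[OF that] by (intro integrable_mult_indicator) auto
  qed
  have fv: "(LINT x:T|lborel. f x) = (LINT x:T|lborel. v x)" if "T \<in> \<T>" for T
    using T(2)[OF that] unfolding set_lebesgue_integral_def f_def
    by (intro Bochner_Integration.integral_cong) (auto split: split_indicator)
  note E = uniformly_distributed_on_integral[OF Z T(3,4,5) f(1) f(2)]
  have Q: "Q_MC D \<T> Z v = (\<lambda>\<omega>. \<Sum>T\<in>\<T>. measure lborel T * f (Z T \<omega>))"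
    by (simp add: fun_eq_iff Q_MC_def f_def)
  show "integrable M (Q_MC D \<T> Z v)"
    unfolding Q using E(1) by (intro Bochner_Integration.integrable_sum integrable_mult_right) auto
  have "expectation (Q_MC D \<T> Z v) = (\<Sum>T\<in>\<T>. measure lborel T * expectation (\<lambda>\<omega>. f (Z T \<omega>)))"
    unfolding Q using E(1) by (subst Bochner_Integration.integral_sum) auto
  also have "\<dots> = (\<Sum>T\<in>\<T>. LINT x:T|lborel. v x)"
    using E(2) fv by (intro sum.cong) auto
  also have "\<dots> = (LINT x:D|lborel. v x)"
    by (rule admissible_triangulation_integral[OF adm \<open>open D\<close> v, symmetric])
  finally show "expectation (Q_MC D \<T> Z v) = (LINT x:D|lborel. v x)" .
qed

text \<open>Unbiasedness makes the mean square error the variance of the sum, and independence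
  splits it into the variances \<open>V T\<close> of the single terms. The sign of
  \<open>V T\<close> is stated because the later summation in \<open>ennreal\<close> requires
  it.\<close>

lemma (in prob_space) Q_MC_mean_square_error:
  assumes adm: "admissible_triangulation D \<T>" and "open D" "bounded D"
    and ind: "indep_vars (\<lambda>_. borel) Z \<T>"
    and Z: "\<And>T. T \<in> \<T> \<Longrightarrow> uniformly_distributed_on M (Z T) T"
    and v: "in_L2 D v"
  defines "V T \<equiv> measure lborel T * (LINT x:T|lborel. (v x)\<^sup>2) - (LINT x:T|lborel. v x)\<^sup>2"
  shows "integrable M (\<lambda>\<omega>. \<bar>(LINT x:D|lborel. v x) - Q_MC D \<T> Z v \<omega>\<bar>\<^sup>2)"
    and "expectation (\<lambda>\<omega>. \<bar>(LINT x:D|lborel. v x) - Q_MC D \<T> Z v \<omega>\<bar>\<^sup>2) = (\<Sum>T\<in>\<T>. V T)"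
    and "T \<in> \<T> \<Longrightarrow> 0 \<le> V T"
    and "\<lbrakk>T \<in> \<T>; 0 \<le> s\<rbrakk> \<Longrightarrow> ennreal (V T)
      \<le> ennreal (max_edge_length \<T> powr (2 + 2 * s)) * slobodeckij_integral s T (\<lambda>x. indicator D x * v x)"
proof -
  note T = admissible_triangulation_triangle[OF adm]
  have v1: "set_integrable lborel D v"
    using in_L2_imp_set_integrable[OF v] assms(2,3) by simp
  define f where "f x = indicator D x * v x" for x
  have f_int: "integrable lborel f" "integrable lborel (\<lambda>x. (f x)\<^sup>2)"
  proof -
    show "integrable lborel f"
      using v1 by (simp add: set_integrable_def f_def[abs_def])
    have "(\<lambda>x. (f x)\<^sup>2) = (\<lambda>x. indicator D x * \<bar>v x\<bar>\<^sup>2)"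
      by (auto simp: f_def split: split_indicator)
    then show "integrable lborel (\<lambda>x. (f x)\<^sup>2)"
      using v by (simp add: in_L2_def set_integrable_def)
  qed
  have f [measurable]: "f \<in> borel_measurable borel"
    using f_int(1) by (auto dest: borel_measurable_integrable)
  have fT: "set_integrable lborel T f" "set_integrable lborel T (\<lambda>x. (f x)\<^sup>2)" if "T \<in> \<T>" for T
    unfolding set_integrable_def using f_int T(3)[OF that]
    by (auto intro!: integrable_mult_indicator simp del: real_scaleR_def)
  have fv: "(LINT x:T|lborel. f x) = (LINT x:T|lborel. v x)"
      "(LINT x:T|lborel. (f x)\<^sup>2) = (LINT x:T|lborel. (v x)\<^sup>2)" if "T \<in> \<T>" for T
    using T(2)[OF that] unfolding set_lebesgue_integral_def f_def
    by (auto intro!: Bochner_Integration.integral_cong split: split_indicator)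
  define X where "X T \<omega> = measure lborel T * f (Z T \<omega>)" for T \<omega>
  have X: "integrable M (X T)" "integrable M (\<lambda>\<omega>. (X T \<omega>)\<^sup>2)" "variance (X T) = V T" if "T \<in> \<T>" for T
  proof -
    show "integrable M (X T)"
      unfolding X_def using uniformly_distributed_on_integral(1)[OF Z T(3,4,5) f fT(1)] that by simp
    show "integrable M (\<lambda>\<omega>. (X T \<omega>)\<^sup>2)"
      unfolding X_def power_mult_distrib
      using variance_scaled_uniform(1)[OF Z T(3,4,5) f fT] that by simp
    show "variance (X T) = V T"
      unfolding X_def V_def fv[OF that, symmetric]
      using variance_scaled_uniform(2)[OF Z T(3,4,5) f fT] that by simp
  qed
  have Q: "Q_MC D \<T> Z v = (\<lambda>\<omega>. \<Sum>T\<in>\<T>. X T \<omega>)"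
    by (simp add: fun_eq_iff Q_MC_def X_def f_def)
  have fin: "finite \<T>"
    using adm by (simp add: admissible_triangulation_def)
  have "indep_vars (\<lambda>_. borel) X \<T>"
    unfolding X_def by (rule indep_vars_compose2[OF ind]) simp
  note var = variance_sum_indep_vars[OF fin this X(1,2)]
  have EQ: "integrable M (\<lambda>\<omega>. \<Sum>T\<in>\<T>. X T \<omega>)" "expectation (\<lambda>\<omega>. \<Sum>T\<in>\<T>. X T \<omega>) = (LINT x:D|lborel. v x)"
    using Q_MC_expectation[OF adm \<open>open D\<close> Z v1] unfolding Q by auto
  \<comment> \<open>The exact integral is the expectation of the sum, so the squared error is the
    squared deviation from the mean.\<close>
  have err: "\<bar>(LINT x:D|lborel. v x) - Q_MC D \<T> Z v \<omega>\<bar>\<^sup>2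
      = ((\<Sum>T\<in>\<T>. X T \<omega>) - expectation (\<lambda>\<omega>. \<Sum>T\<in>\<T>. X T \<omega>))\<^sup>2" for \<omega>
    unfolding EQ(2) unfolding Q by (simp add: power2_commute)
  show "integrable M (\<lambda>\<omega>. \<bar>(LINT x:D|lborel. v x) - Q_MC D \<T> Z v \<omega>\<bar>\<^sup>2)"
    unfolding err power2_diff using var(1) EQ(1) by simp
  show "expectation (\<lambda>\<omega>. \<bar>(LINT x:D|lborel. v x) - Q_MC D \<T> Z v \<omega>\<bar>\<^sup>2) = (\<Sum>T\<in>\<T>. V T)"
    unfolding err using var(2) X(3) by simp
  show "0 \<le> V T" if "T \<in> \<T>" for T
    unfolding X(3)[OF that, symmetric] by (rule variance_positive)
  show "ennreal (V T) \<le> ennreal (max_edge_length \<T> powr (2 + 2 * s))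
      * slobodeckij_integral s T (\<lambda>x. indicator D x * v x)" if "T \<in> \<T>" "0 \<le> s" for T
    unfolding V_def fv[OF that(1), symmetric] f_def[symmetric]
    using variance_le_slobodeckij[OF T(3,5) f fT, OF that(1) that(1) that(1) that(1)] T(6)[OF that(1)] that(2) by blast
qed

theorem lemma3p1:
  fixes D :: "plane set" and \<T> :: "plane set set" and h :: real
    and M :: "'a measure" and Z :: "plane set \<Rightarrow> 'a \<Rightarrow> plane"
  assumes "polygonal_domain D" and "bounded D" and "convex D"
    and "admissible_triangulation D \<T>"
    and "h = max_edge_length \<T>" and "0 < h" and "h \<le> 1"
    and "prob_space M"
    and "prob_space.indep_vars M (\<lambda>_. borel) Z \<T>"
    and "\<And>T. T \<in> \<T> \<Longrightarrow> uniformly_distributed_on M (Z T) T"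
  shows "(\<forall>v. set_integrable lborel D v \<longrightarrow>
            integrable M (Q_MC D \<T> Z v) \<and>
            (\<integral>\<omega>. Q_MC D \<T> Z v \<omega> \<partial>M) = (LINT x:D|lborel. v x))
       \<and> (\<forall>v. in_L2 D v \<longrightarrow>
            integrable M (\<lambda>\<omega>. \<bar>(LINT x:D|lborel. v x) - Q_MC D \<T> Z v \<omega>\<bar>\<^sup>2) \<and>
            (\<integral>\<omega>. \<bar>(LINT x:D|lborel. v x) - Q_MC D \<T> Z v \<omega>\<bar>\<^sup>2 \<partial>M)
              \<le> sqrt 3 / 2 * h\<^sup>2 * (L2_norm D v)\<^sup>2)
       \<and> (\<forall>v s. 0 < s \<and> s < 1 \<and> in_Ws2 s D v \<longrightarrow>
            integrable M (\<lambda>\<omega>. \<bar>(LINT x:D|lborel. v x) - Q_MC D \<T> Z v \<omega>\<bar>\<^sup>2) \<and>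
            (\<integral>\<omega>. \<bar>(LINT x:D|lborel. v x) - Q_MC D \<T> Z v \<omega>\<bar>\<^sup>2 \<partial>M)
              \<le> h powr (2 + 2 * s) * (slobodeckij_seminorm s D v)\<^sup>2)"
proof -
  interpret prob_space M
    by fact
  have "open D"
    using assms(1) by (simp add: polygonal_domain_def)
  note T = admissible_triangulation_triangle[OF assms(4)]
  note expect = Q_MC_expectation[OF assms(4) \<open>open D\<close> assms(10)]
  note mse = Q_MC_mean_square_error[OF assms(4) \<open>open D\<close> assms(2,9,10)]
  define V where "V v T = measure lborel T * (LINT x:T|lborel. (v x)\<^sup>2) - (LINT x:T|lborel. v x)\<^sup>2"
    for v :: "plane \<Rightarrow> real" and T
  have error: "integrable M (\<lambda>\<omega>. \<bar>(LINT x:D|lborel. v x) - Q_MC D \<T> Z v \<omega>\<bar>\<^sup>2)"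
      "expectation (\<lambda>\<omega>. \<bar>(LINT x:D|lborel. v x) - Q_MC D \<T> Z v \<omega>\<bar>\<^sup>2) = (\<Sum>T\<in>\<T>. V v T)"
    if "in_L2 D v" for v
    using mse(1)[OF _ that] mse(2)[OF _ that] unfolding V_def by blast+
  have L2: "(\<Sum>T\<in>\<T>. V v T) \<le> sqrt 3 / 2 * h\<^sup>2 * (L2_norm D v)\<^sup>2" if v: "in_L2 D v" for v
  proof -
    have v2: "set_integrable lborel D (\<lambda>x. (v x)\<^sup>2)"
      using v by (simp add: in_L2_def)
    have nonneg: "0 \<le> (LINT x:A|lborel. (v x)\<^sup>2)" for A
      unfolding set_lebesgue_integral_def by (rule Bochner_Integration.integral_nonneg) simp
    have "(\<Sum>T\<in>\<T>. V v T) \<le> (\<Sum>T\<in>\<T>. h\<^sup>2 / 2 * (LINT x:T|lborel. (v x)\<^sup>2))"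
    proof (rule sum_mono)
      fix T assume "T \<in> \<T>"
      then have "measure lborel T \<le> h\<^sup>2 / 2"
        unfolding assms(5) by (rule T(7))
      then have "measure lborel T * (LINT x:T|lborel. (v x)\<^sup>2) \<le> h\<^sup>2 / 2 * (LINT x:T|lborel. (v x)\<^sup>2)"
        using nonneg by (rule mult_right_mono)
      then show "V v T \<le> h\<^sup>2 / 2 * (LINT x:T|lborel. (v x)\<^sup>2)"
        unfolding V_def using zero_le_power2[of "LINT x:T|lborel. v x"] by linarith
    qed
    also have "\<dots> = 1 / 2 * (h\<^sup>2 * (LINT x:D|lborel. (v x)\<^sup>2))"
      by (simp add: admissible_triangulation_integral[OF assms(4) \<open>open D\<close> v2] sum_distrib_left)
    \<comment> \<open>The area bound produces the constant \<open>1/2\<close>, and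
      \<open>1 \<le> sqrt 3\<close>.\<close>
    also have "\<dots> \<le> sqrt 3 / 2 * (h\<^sup>2 * (LINT x:D|lborel. (v x)\<^sup>2))"
      using nonneg by (intro mult_right_mono) auto
    also have "\<dots> = sqrt 3 / 2 * h\<^sup>2 * (L2_norm D v)\<^sup>2"
      using nonneg by (simp add: L2_norm_def)
    finally show ?thesis .
  qed
  have Ws2: "(\<Sum>T\<in>\<T>. V v T) \<le> h powr (2 + 2 * s) * (slobodeckij_seminorm s D v)\<^sup>2"
    if s: "0 < s" and v: "in_Ws2 s D v" for s v
  proof -
    let ?f = "\<lambda>x. indicator D x * v x" and ?c = "h powr (2 + 2 * s)"
    have vL2: "in_L2 D v" and fin: "slobodeckij_integral s D v < \<infinity>"
      using v by (auto simp: in_Ws2_def)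
    have f: "?f \<in> borel_measurable borel"
      using vL2 by (simp add: in_L2_def set_borel_measurable_def)
    \<comment> \<open>The estimate runs in \<open>ennreal\<close>, where the Slobodeckij integrals
      take their values; it uses the zero extension \<open>?f\<close>, which is globally
      Borel.\<close>
    have "ennreal (\<Sum>T\<in>\<T>. V v T) = (\<Sum>T\<in>\<T>. ennreal (V v T))"
      using mse(3)[OF _ vL2] unfolding V_def by (intro sum_ennreal[symmetric]) auto
    also have "\<dots> \<le> (\<Sum>T\<in>\<T>. ennreal ?c * slobodeckij_integral s T ?f)"
      using mse(4)[OF _ vL2, of _ s] s unfolding V_def assms(5) by (intro sum_mono) auto
    also have "\<dots> = ennreal ?c * (\<Sum>T\<in>\<T>. slobodeckij_integral s T ?f)"
      by (simp add: sum_distrib_left)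
    also have "\<dots> \<le> ennreal ?c * slobodeckij_integral s D ?f"
      using assms(4) T \<open>open D\<close> f
      by (intro mult_left_mono sum_slobodeckij_integral_le) (auto simp: admissible_triangulation_def)
    also have "slobodeckij_integral s D ?f = slobodeckij_integral s D v"
      by (rule slobodeckij_integral_cong) simp
    \<comment> \<open>Finiteness is essential: \<open>enn2real\<close> sends
      \<open>\<infinity>\<close> to \<open>0\<close>.\<close>
    also have "slobodeckij_integral s D v = ennreal ((slobodeckij_seminorm s D v)\<^sup>2)"
      using fin by (simp add: slobodeckij_seminorm_def)
    finally show ?thesis
      by (simp add: ennreal_mult'[symmetric])
  qed
  show ?thesis
  proof (intro conjI allI impI; (elim conjE)?)
    fix v :: "plane \<Rightarrow> real"
    assume "set_integrable lborel D v"
    then show "integrable M (Q_MC D \<T> Z v)" "expectation (Q_MC D \<T> Z v) = (LINT x:D|lborel. v x)"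
      using expect by blast+
  next
    fix v
    assume v: "in_L2 D v"
    show "integrable M (\<lambda>\<omega>. \<bar>(LINT x:D|lborel. v x) - Q_MC D \<T> Z v \<omega>\<bar>\<^sup>2)"
      "expectation (\<lambda>\<omega>. \<bar>(LINT x:D|lborel. v x) - Q_MC D \<T> Z v \<omega>\<bar>\<^sup>2)
        \<le> sqrt 3 / 2 * h\<^sup>2 * (L2_norm D v)\<^sup>2"
      using error[OF v] L2[OF v] by auto
  next
    fix v s
    assume s: "0 < s" and v: "in_Ws2 s D v"
    then have "in_L2 D v"
      by (simp add: in_Ws2_def)
    then show "integrable M (\<lambda>\<omega>. \<bar>(LINT x:D|lborel. v x) - Q_MC D \<T> Z v \<omega>\<bar>\<^sup>2)"
      "expectation (\<lambda>\<omega>. \<bar>(LINT x:D|lborel. v x) - Q_MC D \<T> Z v \<omega>\<bar>\<^sup>2)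
        \<le> h powr (2 + 2 * s) * (slobodeckij_seminorm s D v)\<^sup>2"
      using error Ws2[OF s v] by auto
  qed
qed

end
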